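(* For every integer $r \geq 2$, the $(2r+2)\times(2r+2)$ $0,1$-matrix $N = \begin{pmatrix} A' & B \\ J & A'^{\dagger}\end{pmatrix}$ is primitive with exponent $3$, and the level poset associated to $N$ is Eulerian.
   Context: Blocks (all $(r+1)\times(r+1)$, indexed by $0\le i,j\le r$): $A'=(a'_{i,j})$ with $a'_{i,j}=1$ if ($i=0$ and $j\le r-1$) or ($i=1$ and $j=r$), and $0$ otherwise; $B=(b_{i,j})$ with $b_{i,j}=1$ if $0\le i-j\le 1$ and $0$ otherwise; $J$ is the all-ones matrix; $A'^{\dagger}$ is the reflection of $A'$ over its anti-diagonal, i.e. $(A'^{\dagger})_{i,j}=a'_{r-j,r-i}$. For a non-negative matrix $X$, $\mathrm{Bin}(X)$ is the $0,1$-matrix with entry $1$ exactly where the entry of $X$ is positive. A non-negative square matrix $X$ is primitive if there is a positive integer $k$ such that all entries of $\mathrm{Bin}(X^k)$ equal $1$; the smallest such $k$ is the exponent of $X$. The level poset associated to an $n\times n$ $0,1$-matrix $X=(x_{i,j})$ is the ranked poset on (index set of size $n$) $\times\mathbb{Z}$ whose cover relations are $(i,s)\prec(j,s+1)$ if and only if $x_{i,j}=1$; the rank of $(i,s)$ is $s$. Equivalently $(i,s)\le(j,p)$ if and only if $p \geq s$ and $\mathrm{Bin}(X^{p-s})_{i,j}=1$, with $X^0$ the identity matrix. A ranked poset is Eulerian if every non-singleton interval $[x,y]=\{z: x\le z\le y\}$ has as many elements of even rank as of odd rank. *)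

theory Defs
  imports Complex_Main "Jordan_Normal_Form.Matrix"
begin

definition bin_mat :: "real mat \<Rightarrow> real mat" where
  "bin_mat X = map_mat (\<lambda>x. if x > 0 then 1 else 0) X"

definition nonneg_square_mat :: "real mat \<Rightarrow> bool" where
  "nonneg_square_mat X \<longleftrightarrow> square_mat X \<and>
     (\<forall>i<dim_row X. \<forall>j<dim_col X. X $$ (i, j) \<ge> 0)"

definition power_all_positive :: "real mat \<Rightarrow> nat \<Rightarrow> bool" where
  "power_all_positive X k \<longleftrightarrow>
     (\<forall>i<dim_row X. \<forall>j<dim_col X. bin_mat (X ^\<^sub>m k) $$ (i, j) = 1)"

definition primitive_mat :: "real mat \<Rightarrow> bool" where
  "primitive_mat X \<longleftrightarrow> nonneg_square_mat X \<and> (\<exists>k>0. power_all_positive X k)"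

text \<open>Only meaningful for primitive matrices; for others such a \<open>k\<close> need not exist.\<close>

definition mat_exponent :: "real mat \<Rightarrow> nat" where
  "mat_exponent X = (LEAST k. k > 0 \<and> power_all_positive X k)"

definition covers :: "'a rel \<Rightarrow> 'a \<Rightarrow> 'a \<Rightarrow> bool" where
  "covers R x y \<longleftrightarrow> (x, y) \<in> R \<and> x \<noteq> y \<and>
     (\<forall>z. (x, z) \<in> R \<and> (z, y) \<in> R \<longrightarrow> z = x \<or> z = y)"

text \<open>Posets need not have a least or a greatest element, and ranks may be
  negative.  Strict monotonicity of the rank is required explicitly because
  the condition on covers is vacuous for, say, dense orders.\<close>

definition ranked_poset :: "'a set \<Rightarrow> 'a rel \<Rightarrow> ('a \<Rightarrow> int) \<Rightarrow> bool" where
  "ranked_poset P R rk \<longleftrightarrow> partial_order_on P R \<and>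
     (\<forall>x y. (x, y) \<in> R \<and> x \<noteq> y \<longrightarrow> rk x < rk y) \<and>
     (\<forall>x y. covers R x y \<longrightarrow> rk y = rk x + 1)"

definition poset_interval :: "'a rel \<Rightarrow> 'a \<Rightarrow> 'a \<Rightarrow> 'a set" where
  "poset_interval R x y = {z. (x, z) \<in> R \<and> (z, y) \<in> R}"

text \<open>Finiteness of the intervals is demanded so that comparing the numbers
  of elements through \<^const>\<open>card\<close> is meaningful.\<close>

definition eulerian_poset :: "'a set \<Rightarrow> 'a rel \<Rightarrow> ('a \<Rightarrow> int) \<Rightarrow> bool" where
  "eulerian_poset P R rk \<longleftrightarrow> ranked_poset P R rk \<and>
     (\<forall>x y. (x, y) \<in> R \<and> x \<noteq> y \<longrightarrow>
        finite (poset_interval R x y) \<and>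
        card {z \<in> poset_interval R x y. even (rk z)} =
        card {z \<in> poset_interval R x y. odd (rk z)})"

definition level_elems :: "real mat \<Rightarrow> (nat \<times> int) set" where
  "level_elems X = {0..<dim_row X} \<times> UNIV"

definition level_step :: "real mat \<Rightarrow> (nat \<times> int) rel" where
  "level_step X = {((i, s), (j, s + 1)) | i j s.
     i < dim_row X \<and> j < dim_row X \<and> X $$ (i, j) = 1}"

text \<open>The intersection removes the reflexive pairs outside the carrier.\<close>

definition level_le :: "real mat \<Rightarrow> (nat \<times> int) rel" where
  "level_le X = (level_step X)\<^sup>* \<inter> (level_elems X \<times> level_elems X)"

abbreviation (input) level_rank :: "nat \<times> int \<Rightarrow> int" where
  "level_rank \<equiv> snd"

lemma level_step_rank: "(x, y) \<in> (level_step X)\<^sup>* \<Longrightarrow> x = y \<or> snd x < snd y"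
  by (induction rule: rtrancl_induct) (auto simp: level_step_def)

lemma covers_level_le: "covers (level_le X) x y \<longleftrightarrow> (x, y) \<in> level_step X"
proof
  assume c: "covers (level_le X) x y"
  then have "(x, y) \<in> (level_step X)\<^sup>*" "x \<noteq> y" "x \<in> level_elems X" "y \<in> level_elems X"
    by (auto simp: covers_def level_le_def)
  then obtain z where z: "(x, z) \<in> level_step X" "(z, y) \<in> (level_step X)\<^sup>*"
    by (metis converse_rtranclE)
  then have "z \<in> level_elems X" "z \<noteq> x"
    by (auto simp: level_step_def level_elems_def)
  with c z \<open>x \<in> level_elems X\<close> \<open>y \<in> level_elems X\<close> have "z = y"
    unfolding covers_def level_le_def by (metis IntI SigmaI r_into_rtrancl)
  with z show "(x, y) \<in> level_step X" by simp
next
  assume s: "(x, y) \<in> level_step X"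
  then have e: "x \<in> level_elems X" "y \<in> level_elems X" "x \<noteq> y" "snd y = snd x + 1"
    by (auto simp: level_step_def level_elems_def)
  have "z = x \<or> z = y" if "(x, z) \<in> level_le X" "(z, y) \<in> level_le X" for z
  proof -
    from that have "x = z \<or> snd x < snd z" "z = y \<or> snd z < snd y"
      unfolding level_le_def by (blast dest: level_step_rank)+
    with e(4) show ?thesis by auto
  qed
  with s e show "covers (level_le X) x y"
    by (auto simp: covers_def level_le_def)
qed

lemma level_le_iff_bin_mat:
  assumes X: "X \<in> carrier_mat n n"
    and X01: "\<And>i j. i < n \<Longrightarrow> j < n \<Longrightarrow> X $$ (i, j) \<in> {0, 1}"
    and i: "i < n" and j: "j < n"
  shows "((i, s), (j, p)) \<in> level_le X \<longleftrightarrow>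
    p \<ge> s \<and> bin_mat (X ^\<^sub>m nat (p - s)) $$ (i, j) = 1"
proof -
  have car: "X ^\<^sub>m k \<in> carrier_mat n n" for k
    using X by simp
  have dims: "dim_row X = n" "dim_col X = n"
    using X by auto
  have ent: "(X ^\<^sub>m Suc k) $$ (i, j) = (\<Sum>l = 0..<n. (X ^\<^sub>m k) $$ (i, l) * X $$ (l, j))"
    if "j < n" for k j
    using car[of k] X i that by (simp add: scalar_prod_def)
  have nn: "(X ^\<^sub>m k) $$ (i, j) \<ge> 0" if "j < n" for k j
    using that
  proof (induction k arbitrary: j)
    case 0
    then show ?case using X i by simp
  next
    case (Suc k)
    have "0 \<le> (X ^\<^sub>m k) $$ (i, l) * X $$ (l, j)" if "l < n" for l
      using Suc.IH[OF that] X01[OF that Suc.prems] by auto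
    then show ?case
      unfolding ent[OF Suc.prems] by (intro sum_nonneg) auto
  qed
  have relpow: "((i, s), y) \<in> level_step X ^^ k \<longleftrightarrow>
      fst y < n \<and> snd y = s + int k \<and> (X ^\<^sub>m k) $$ (i, fst y) > 0" for k y
  proof (induction k arbitrary: y)
    case 0
    then show ?case using X i by (cases y) (auto split: if_splits)
  next
    case (Suc k)
    obtain j q where y: "y = (j, q)" by fastforce
    have "((i, s), y) \<in> level_step X ^^ Suc k \<longleftrightarrow>
        (\<exists>z. ((i, s), z) \<in> level_step X ^^ k \<and> (z, y) \<in> level_step X)"
      by auto
    also have "\<dots> \<longleftrightarrow> (\<exists>l<n. j < n \<and> q = s + int (Suc k) \<and>
        (X ^\<^sub>m k) $$ (i, l) > 0 \<and> X $$ (l, j) = 1)"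
      unfolding Suc.IH y by (auto simp: level_step_def dims)
    also have "\<dots> \<longleftrightarrow> j < n \<and> q = s + int (Suc k) \<and>
        (\<exists>l<n. (X ^\<^sub>m k) $$ (i, l) > 0 \<and> X $$ (l, j) = 1)"
      by blast
    also have "\<dots> \<longleftrightarrow> j < n \<and> q = s + int (Suc k) \<and> (X ^\<^sub>m Suc k) $$ (i, j) > 0"
    proof (cases "j < n")
      case True
      have f: "0 \<le> (X ^\<^sub>m k) $$ (i, l) * X $$ (l, j)" if "l < n" for l
        using nn[OF that, of k] X01[OF that True] by auto
      have "(X ^\<^sub>m Suc k) $$ (i, j) > 0 \<longleftrightarrow>
          (\<exists>l<n. (X ^\<^sub>m k) $$ (i, l) * X $$ (l, j) \<noteq> 0)"
        using sum_nonneg_eq_0_iff[of "{0..<n}" "\<lambda>l. (X ^\<^sub>m k) $$ (i, l) * X $$ (l, j)"]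
          f sum_nonneg[of "{0..<n}" "\<lambda>l. (X ^\<^sub>m k) $$ (i, l) * X $$ (l, j)"]
        unfolding ent[OF True] by (auto simp: less_le)
      also have "\<dots> \<longleftrightarrow> (\<exists>l<n. (X ^\<^sub>m k) $$ (i, l) > 0 \<and> X $$ (l, j) = 1)"
        using nn[of _ k] X01[OF _ True] by (fastforce simp: less_le)
      finally show ?thesis by simp
    qed simp
    finally show ?case using y by simp
  qed
  have "((i, s), (j, p)) \<in> level_le X \<longleftrightarrow> (\<exists>k. ((i, s), (j, p)) \<in> level_step X ^^ k)"
    using i j by (auto simp: level_le_def level_elems_def dims rtrancl_power)
  also have "\<dots> \<longleftrightarrow> p \<ge> s \<and> (X ^\<^sub>m nat (p - s)) $$ (i, j) > 0"
    unfolding relpow using j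
    by (auto intro!: exI[of _ "nat (p - s)"])
  finally show ?thesis
    using i j carrier_matD[OF car[of "nat (p - s)"]] by (auto simp: bin_mat_def)
qed

definition block_A' :: "nat \<Rightarrow> real mat" where
  "block_A' r = mat (r + 1) (r + 1) (\<lambda>(i, j).
     if (i = 0 \<and> j \<le> r - 1) \<or> (i = 1 \<and> j = r) then 1 else 0)"

text \<open>The integer coercions avoid truncated subtraction.\<close>

definition block_B :: "nat \<Rightarrow> real mat" where
  "block_B r = mat (r + 1) (r + 1) (\<lambda>(i, j).
     if 0 \<le> int i - int j \<and> int i - int j \<le> 1 then 1 else 0)"

definition block_J :: "nat \<Rightarrow> real mat" where
  "block_J r = mat (r + 1) (r + 1) (\<lambda>_. 1)"

definition block_A'_dagger :: "nat \<Rightarrow> real mat" where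
  "block_A'_dagger r = mat (r + 1) (r + 1) (\<lambda>(i, j). block_A' r $$ (r - j, r - i))"

definition N_mat :: "nat \<Rightarrow> real mat" where
  "N_mat r = four_block_mat (block_A' r) (block_B r) (block_J r) (block_A'_dagger r)"

lemma N_mat_carrier: "N_mat r \<in> carrier_mat (2 * r + 2) (2 * r + 2)"
  by (auto simp: N_mat_def block_A'_def block_A'_dagger_def)

end

theory Submission
  imports Defs
begin

text \<open>The supports of \<open>N\<close> and \<open>N\<^sup>2\<close> are explicit, and all entries of \<open>N\<^sup>2\<close> are 0 or 2, so that
  intervals of length 2 have two middle elements; \<open>N\<^sup>3\<close> is positive.  In the alternating sum
  of the level sizes of an interval, the levels at distance at least 3 from both ends are full.
  Every row of \<open>N\<^sup>2\<close> has exactly \<open>r\<close> more nonzero entries than the same row of \<open>N\<close>, and so does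
  every column, since \<open>N\<close> is symmetric about its anti-diagonal.  Hence the two levels next to
  each end contribute \<open>r\<close> up to sign, and together with the end elements they cancel the
  \<open>2 r + 2\<close> of an unpaired full level.\<close>

section \<open>Supports of \<open>N\<close> and of its powers\<close>

text \<open>The disjuncts come in block order: two for \<open>A'\<close>, the diagonal and the
  subdiagonal of \<open>B\<close>, one for \<open>J\<close>, two for the reflected block. The bound
  \<open>2 * r + 2\<close> on indices is left to the places of use.\<close>

definition edge :: "nat \<Rightarrow> nat \<Rightarrow> nat \<Rightarrow> bool" where
  "edge r i j \<longleftrightarrow> i = 0 \<and> j < r \<or> i = 1 \<and> j = r \<or> i \<le> r \<and> j = r + 1 + i \<or>
     1 \<le> i \<and> i \<le> r \<and> j = r + i \<or> r < i \<and> j \<le> r \<or>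
     r + 1 < i \<and> j = 2 * r + 1 \<or> i = r + 1 \<and> j = 2 * r"

text \<open>The support of \<open>N\<^sup>2\<close>, see \<open>card_two_paths\<close>.\<close>

definition edge2 :: "nat \<Rightarrow> nat \<Rightarrow> nat \<Rightarrow> bool" where
  "edge2 r i j \<longleftrightarrow> r < i \<or> j \<le> r \<or> i = 0 \<and> j \<le> 2 * r \<or>
     1 \<le> i \<and> j = 2 * r + 1 \<or> i = 1 \<and> j = 2 * r"

text \<open>Meant as the support of the \<open>k\<close>-th power on indices below
  \<open>2 * r + 2\<close>. The value \<open>True\<close> from \<open>k = 3\<close> on anticipates
  positivity; \<open>reach_Suc\<close> justifies it.\<close>

definition reach :: "nat \<Rightarrow> nat \<Rightarrow> nat \<Rightarrow> nat \<Rightarrow> bool" where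
  "reach r k i j \<longleftrightarrow>
     (if k = 0 then i = j else if k = 1 then edge r i j else if k = 2 then edge2 r i j else True)"

lemma N_mat_entry:
  assumes "r \<ge> 2" "i < 2 * r + 2" "j < 2 * r + 2"
  shows "N_mat r $$ (i, j) = (if edge r i j then 1 else 0)"
proof -
  have dims: "dim_row (block_A' r) = r + 1" "dim_col (block_A' r) = r + 1"
    "dim_row (block_A'_dagger r) = r + 1" "dim_col (block_A'_dagger r) = r + 1"
    by (simp_all add: block_A'_def block_A'_dagger_def)
  have entry: "N_mat r $$ (i, j) =
     (if i < r + 1 then if j < r + 1 then block_A' r $$ (i, j) else block_B r $$ (i, j - (r + 1))
      else if j < r + 1 then block_J r $$ (i - (r + 1), j)
        else block_A'_dagger r $$ (i - (r + 1), j - (r + 1)))"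
    unfolding N_mat_def
    by (subst index_mat_four_block(1)) (unfold dims, use assms in simp_all)
  consider "i \<le> r" "j \<le> r" | "i \<le> r" "r < j" | "r < i" "j \<le> r" | "r < i" "r < j"
    by linarith
  then show ?thesis
  proof cases
    case 1
    then have "N_mat r $$ (i, j) = (if (i = 0 \<and> j \<le> r - 1) \<or> (i = 1 \<and> j = r) then 1 else 0)"
      unfolding entry by (simp add: block_A'_def)
    moreover have "edge r i j \<longleftrightarrow> (i = 0 \<and> j \<le> r - 1) \<or> (i = 1 \<and> j = r)"
      using 1 assms(1) by (simp add: edge_def) linarith
    ultimately show ?thesis by simp
  next
    case 2
    obtain b where b: "j = r + 1 + b" "b \<le> r"
      using 2(2) assms(3) by (auto dest: less_imp_Suc_add)
    have "N_mat r $$ (i, j) = (if 0 \<le> int i - int b \<and> int i - int b \<le> 1 then 1 else 0)"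
      unfolding entry unfolding b(1) using 2(1) b(2) by (simp add: block_B_def)
    moreover have "edge r i j \<longleftrightarrow> i = b \<or> i = b + 1"
      unfolding b(1) edge_def using 2(1) b(2) by simp linarith
    moreover have "i = b \<or> i = b + 1 \<longleftrightarrow> 0 \<le> int i - int b \<and> int i - int b \<le> 1"
      by linarith
    ultimately show ?thesis by simp
  next
    case 3
    then have "N_mat r $$ (i, j) = 1"
      unfolding entry using assms by (simp add: block_J_def)
    moreover have "edge r i j"
      unfolding edge_def using 3 by simp
    ultimately show ?thesis by simp
  next
    case 4
    obtain a where a: "i = r + 1 + a" "a \<le> r"
      using 4(1) assms(2) by (auto dest: less_imp_Suc_add)
    obtain b where b: "j = r + 1 + b" "b \<le> r"
      using 4(2) assms(3) by (auto dest: less_imp_Suc_add)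
    have "N_mat r $$ (i, j) = block_A' r $$ (r - b, r - a)"
      unfolding entry unfolding a(1) b(1) using a(2) b(2) by (simp add: block_A'_dagger_def)
    \<comment> \<open>The reflection turns row \<open>0\<close> of \<open>A'\<close> into the last
      column without its first entry, and the entry at \<open>(1, r)\<close> into one at
      \<open>(0, r - 1)\<close>.\<close>
    also have "\<dots> =
        (if (r - b = 0 \<and> r - a \<le> r - 1) \<or> (r - b = 1 \<and> r - a = r) then 1 else 0)"
      by (simp add: block_A'_def)
    also have "r - b = 0 \<longleftrightarrow> b = r"
      using b(2) by linarith
    also have "r - a \<le> r - 1 \<longleftrightarrow> a \<noteq> 0"
      using a(2) assms(1) by linarith
    also have "r - b = 1 \<longleftrightarrow> b = r - 1"
      using b(2) assms(1) by linarith
    also have "r - a = r \<longleftrightarrow> a = 0"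
      using a(2) assms(1) by linarith
    also have "b = r \<and> a \<noteq> 0 \<or> b = r - 1 \<and> a = 0 \<longleftrightarrow> edge r i j"
      unfolding a(1) b(1) edge_def using assms(1) by simp linarith
    finally show ?thesis .
  qed
qed

text \<open>Explicit successor lists here, and predecessor lists below, make each set of middle
  indices an intersection of two known sets.\<close>

lemma edge_row:
  shows "edge r 0 k \<longleftrightarrow> k < r \<or> k = r + 1"
    and "r \<ge> 2 \<Longrightarrow> edge r 1 k \<longleftrightarrow> k = r \<or> k = r + 1 \<or> k = r + 2"
    and "2 \<le> i \<Longrightarrow> i \<le> r \<Longrightarrow> edge r i k \<longleftrightarrow> k = r + i \<or> k = r + 1 + i"
    and "r < i \<Longrightarrow> edge r i k \<longleftrightarrow> k \<le> r \<or> k = (if i = r + 1 then 2 * r else 2 * r + 1)"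
  unfolding edge_def by auto

lemma edge_col:
  assumes "r \<ge> 2"
  shows "j < r \<Longrightarrow> edge r k j \<longleftrightarrow> k = 0 \<or> r < k"
    and "edge r k r \<longleftrightarrow> k = 1 \<or> r < k"
    and "r < j \<Longrightarrow> j < 2 * r \<Longrightarrow> edge r k j \<longleftrightarrow> k = j - r - 1 \<or> k = j - r"
    and "edge r k (2 * r) \<longleftrightarrow> k = r - 1 \<or> k = r \<or> k = r + 1"
    and "edge r k (2 * r + 1) \<longleftrightarrow> k = r \<or> r + 1 < k"
  using assms unfolding edge_def by (cases "k = 0"; auto)+

section \<open>Paths of length two and more\<close>

text \<open>The cardinality is the entry of the square of \<open>N\<close> at \<open>(i, j)\<close>.
  Four row types against five column types leave twenty intersections, each a named pair or
  empty.\<close>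

lemma card_two_paths:
  assumes r: "r \<ge> 2" and i: "i < 2 * r + 2" and j: "j < 2 * r + 2"
  shows "card {k. k < 2 * r + 2 \<and> edge r i k \<and> edge r k j} = (if edge2 r i j then 2 else 0)"
    (is "card ?P = _")
proof -
  have two: ?thesis if "?P = {a, b}" "a \<noteq> b" "edge2 r i j" for a b
    using that by simp
  have none: ?thesis if "?P = {}" "\<not> edge2 r i j"
    using that by simp
  note col = edge_col[OF r]
  consider (zero) "i = 0" | (one) "i = 1" | (top) "2 \<le> i" "i \<le> r" | (bot) "r < i"
    by linarith
  note rows = this
  consider (lt) "j < r" | (eq) "j = r" | (mid) "r < j" "j < 2 * r" | (pen) "j = 2 * r"
    | (last) "j = 2 * r + 1"
    using j by linarith
  then show ?thesis
  proof cases
    \<comment> \<open>For \<open>j \<le> r\<close> a column consists of all indices above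
      \<open>r\<close> and one more, \<open>0\<close> or \<open>1\<close>. Rows \<open>1\<close> to
      \<open>r\<close> miss that one but have two entries above \<open>r\<close>; every other row
      contains it and has one entry above \<open>r\<close>.\<close>
    case lt
    from rows show ?thesis
    proof cases
      case zero
      show ?thesis by (rule two[of 0 "r + 1"]) (use zero lt r in \<open>auto simp: edge_row col edge2_def\<close>)
    next
      case one
      show ?thesis by (rule two[of "r + 1" "r + 2"])
        (use one lt r in \<open>auto simp: edge_row(2)[OF r, unfolded One_nat_def] col edge2_def\<close>)
    next
      case top
      show ?thesis by (rule two[of "r + i" "r + 1 + i"])
        (use top lt r in \<open>auto simp: edge_row col edge2_def\<close>)
    next
      case bot
      show ?thesis by (rule two[of 0 "if i = r + 1 then 2 * r else 2 * r + 1"])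
        (use bot lt r in \<open>auto simp: edge_row col edge2_def\<close>)
    qed
  next
    case eq
    from rows show ?thesis
    proof cases
      case zero
      show ?thesis by (rule two[of 1 "r + 1"]) (use zero eq r in \<open>auto simp: edge_row col edge2_def\<close>)
    next
      case one
      show ?thesis by (rule two[of "r + 1" "r + 2"])
        (use one eq r in \<open>auto simp: edge_row(2)[OF r, unfolded One_nat_def] col edge2_def\<close>)
    next
      case top
      show ?thesis by (rule two[of "r + i" "r + 1 + i"])
        (use top eq r in \<open>auto simp: edge_row col edge2_def\<close>)
    next
      case bot
      show ?thesis by (rule two[of 1 "if i = r + 1 then 2 * r else 2 * r + 1"])
        (use bot eq r in \<open>auto simp: edge_row col edge2_def\<close>)
    qed
  next
    case mid
    \<comment> \<open>These two are the only predecessors of \<open>j\<close>, and both are below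
      \<open>r\<close>. Row \<open>0\<close> and the rows beyond \<open>r\<close> contain both, the
      remaining rows neither.\<close>
    have ne: "j - r - 1 \<noteq> j - r" using mid by simp
    from rows show ?thesis
    proof cases
      case zero
      show ?thesis by (rule two[OF _ ne]) (use zero mid r in \<open>auto simp: edge_row col edge2_def\<close>)
    next
      case one
      show ?thesis by (rule none)
        (use one mid r in \<open>auto simp: edge_row(2)[OF r, unfolded One_nat_def] col edge2_def\<close>)
    next
      case top
      show ?thesis by (rule none) (use top mid r in \<open>auto simp: edge_row col edge2_def\<close>)
    next
      case bot
      show ?thesis by (rule two[OF _ ne]) (use bot mid r in \<open>auto simp: edge_row col edge2_def\<close>)
    qed
  next
    case pen
    from rows show ?thesis
    proof cases
      case zero
      show ?thesis by (rule two[of "r - 1" "r + 1"])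
        (use zero pen r in \<open>auto simp: edge_row col edge2_def\<close>)
    next
      case one
      show ?thesis by (rule two[of r "r + 1"])
        (use one pen r in \<open>auto simp: edge_row(2)[OF r, unfolded One_nat_def] col edge2_def\<close>)
    next
      case top
      show ?thesis by (rule none) (use top pen r in \<open>auto simp: edge_row col edge2_def\<close>)
    next
      case bot
      show ?thesis by (rule two[of "r - 1" r]) (use bot pen r in \<open>auto simp: edge_row col edge2_def\<close>)
    qed
  next
    case last
    from rows show ?thesis
    proof cases
      case zero
      show ?thesis by (rule none)
        (use zero last r in \<open>auto simp: edge_row col[unfolded Suc_eq_plus1[symmetric]] edge2_def\<close>)
    next
      case one
      show ?thesis by (rule two[of r "r + 2"])
        (use one last r in \<open>auto simp: edge_row(2)[OF r, unfolded One_nat_def]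
           col[unfolded Suc_eq_plus1[symmetric]] edge2_def\<close>)
    next
      case top
      show ?thesis by (rule two[of "r + i" "r + 1 + i"])
        (use top last r in \<open>auto simp: edge_row col[unfolded Suc_eq_plus1[symmetric]] edge2_def\<close>)
    next
      case bot
      show ?thesis by (rule two[of r "if i = r + 1 then 2 * r else 2 * r + 1"])
        (use bot last r in \<open>auto simp: edge_row col[unfolded Suc_eq_plus1[symmetric]] edge2_def\<close>)
    qed
  qed
qed

lemma reach_Suc:
  assumes r: "r \<ge> 2" and i: "i < 2 * r + 2" and j: "j < 2 * r + 2"
  shows "(\<exists>l < 2 * r + 2. reach r k i l \<and> edge r l j) \<longleftrightarrow> reach r (Suc k) i j"
proof -
  consider "k = 0" | "k = 1" | "k \<ge> 2" by linarith
  then show ?thesis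
  proof cases
    case 1
    then show ?thesis using i by (auto simp: reach_def)
  next
    case 2
    have "(\<exists>l < 2 * r + 2. edge r i l \<and> edge r l j) \<longleftrightarrow>
        card {l. l < 2 * r + 2 \<and> edge r i l \<and> edge r l j} \<noteq> 0"
      by auto
    then show ?thesis unfolding card_two_paths[OF r i j] using 2 by (simp add: reach_def)
  next
    case 3
    \<comment> \<open>Every column of \<open>N\<close> has a one in its upper half, and the left
      half of the square is full. So one step after two or more reaches every index.\<close>
    obtain l where "l \<le> r" "edge r l j"
    proof -
      consider "j < r" | "j = r" | "r < j" by linarith
      then show ?thesis
      proof cases
        case 1 then show ?thesis using that[of 0] by (simp add: edge_col[OF r])
      next
        case 2 then show ?thesis using that[of 1] r by (simp add: edge_def)
      next
        case 3 then show ?thesis using that[of "j - r - 1"] j by (simp add: edge_def)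
      qed
    qed
    then show ?thesis using 3 by (auto simp: reach_def edge2_def intro!: exI[of _ l])
  qed
qed

section \<open>The order of the level poset\<close>

lemma relpow_level_step_N_mat:
  assumes r: "r \<ge> 2" and i: "i < 2 * r + 2"
  shows "((i, s), (j, p)) \<in> level_step (N_mat r) ^^ k \<longleftrightarrow>
    j < 2 * r + 2 \<and> p = s + int k \<and> reach r k i j"
proof (induction k arbitrary: j p)
  case 0
  then show ?case using i by (auto simp: reach_def)
next
  case (Suc k)
  have dim: "dim_row (N_mat r) = 2 * r + 2"
    using N_mat_carrier by blast
  have "((i, s), (j, p)) \<in> level_step (N_mat r) ^^ Suc k \<longleftrightarrow>
      (\<exists>l q. ((i, s), (l, q)) \<in> level_step (N_mat r) ^^ k \<and> ((l, q), (j, p)) \<in> level_step (N_mat r))"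
    by auto
  also have "\<dots> \<longleftrightarrow> j < 2 * r + 2 \<and> p = s + int (Suc k) \<and>
      (\<exists>l < 2 * r + 2. reach r k i l \<and> edge r l j)"
    unfolding Suc.IH by (auto simp: level_step_def dim N_mat_entry[OF r] split: if_splits)
  finally show ?case using reach_Suc[OF r i] by blast
qed

text \<open>Every step raises the rank by one, so the rank difference determines the number of
  steps.\<close>

lemma level_le_N_mat:
  assumes r: "r \<ge> 2"
  shows "((i, s), (j, p)) \<in> level_le (N_mat r) \<longleftrightarrow>
    i < 2 * r + 2 \<and> j < 2 * r + 2 \<and> s \<le> p \<and> reach r (nat (p - s)) i j"
proof (cases "i < 2 * r + 2")
  case True
  have "dim_row (N_mat r) = 2 * r + 2"
    using N_mat_carrier by blast
  then have "((i, s), (j, p)) \<in> level_le (N_mat r) \<longleftrightarrow>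
      j < 2 * r + 2 \<and> (\<exists>k. ((i, s), (j, p)) \<in> level_step (N_mat r) ^^ k)"
    using True by (auto simp: level_le_def level_elems_def rtrancl_power)
  then show ?thesis
    unfolding relpow_level_step_N_mat[OF r True] using True by (auto intro: exI[of _ "nat (p - s)"])
next
  case False
  then show ?thesis
    using N_mat_carrier[of r] by (auto simp: level_le_def level_elems_def)
qed

section \<open>Primitivity and exponent\<close>

text \<open>The order between ranks \<open>0\<close> and \<open>k\<close> can be read off the matrix
  power or off \<open>reach\<close>; comparing the two avoids computing powers.\<close>

lemma power_all_positive_N_mat:
  assumes r: "r \<ge> 2"
  shows "power_all_positive (N_mat r) k \<longleftrightarrow> (\<forall>i < 2 * r + 2. \<forall>j < 2 * r + 2. reach r k i j)"
proof -
  have "bin_mat (N_mat r ^\<^sub>m k) $$ (i, j) = 1 \<longleftrightarrow> reach r k i j"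
    if "i < 2 * r + 2" "j < 2 * r + 2" for i j
    using level_le_iff_bin_mat[OF N_mat_carrier _ that, of 0 "int k"]
      level_le_N_mat[OF r, of i 0 j "int k"] N_mat_entry[OF r] that by auto
  then show ?thesis
    using N_mat_carrier[of r] by (auto simp: power_all_positive_def)
qed

lemma primitive_N_mat:
  assumes r: "r \<ge> 2"
  shows "primitive_mat (N_mat r)"
proof -
  have "power_all_positive (N_mat r) 3"
    unfolding power_all_positive_N_mat[OF r] by (simp add: reach_def)
  moreover have "nonneg_square_mat (N_mat r)"
    using N_mat_carrier[of r] N_mat_entry[OF r] by (auto simp: nonneg_square_mat_def)
  ultimately show ?thesis
    unfolding primitive_mat_def by (intro conjI exI[of _ 3]) auto
qed

lemma mat_exponent_N_mat:
  assumes r: "r \<ge> 2"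
  shows "mat_exponent (N_mat r) = 3"
  unfolding mat_exponent_def
proof (rule Least_equality)
  show "0 < (3 :: nat) \<and> power_all_positive (N_mat r) 3"
    unfolding power_all_positive_N_mat[OF r] by (simp add: reach_def)
next
  fix k
  assume "0 < k \<and> power_all_positive (N_mat r) k"
  \<comment> \<open>The top right corner is zero in both \<open>N\<close> and its square.\<close>
  then have "reach r k 0 (2 * r + 1)"
    unfolding power_all_positive_N_mat[OF r] by simp
  then show "3 \<le> k"
    using r by (auto simp: reach_def edge_def edge2_def split: if_splits)
qed

section \<open>Row and column counts\<close>

text \<open>The counts for the square and for \<open>N\<close> are \<open>2 * r + 1\<close> and
  \<open>r + 1\<close> in row \<open>0\<close>, \<open>r + 3\<close> and \<open>3\<close> in row
  \<open>1\<close>, \<open>r + 2\<close> and \<open>2\<close> in rows \<open>2\<close> to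
  \<open>r\<close>, and \<open>2 * r + 2\<close> and \<open>r + 2\<close> below.\<close>

lemma card_edge2_row:
  assumes r: "r \<ge> 2" and i: "i < 2 * r + 2"
  shows "card {k. k < 2 * r + 2 \<and> edge2 r i k} = r + card {k. k < 2 * r + 2 \<and> edge r i k}"
    (is "card ?Q = r + card ?E")
proof -
  consider (zero) "i = 0" | (one) "i = 1" | (top) "2 \<le> i" "i \<le> r" | (bot) "r < i"
    by linarith
  then show ?thesis
  proof cases
    case zero
    then have "?Q = {..2 * r}" "?E = insert (r + 1) {..<r}"
      using r by (auto simp: edge_def edge2_def)
    then show ?thesis by simp
  next
    case one
    then have "?Q = insert (2 * r) (insert (2 * r + 1) {..r})" "?E = {r, r + 1, r + 2}"
      using r by (auto simp: edge_def edge2_def)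
    then show ?thesis using r by simp
  next
    case top
    then have "?Q = insert (2 * r + 1) {..r}" "?E = {r + i, r + 1 + i}"
      by (auto simp: edge_def edge2_def)
    then show ?thesis by simp
  next
    case bot
    then have "?Q = {..<2 * r + 2}"
        "?E = insert (if i = r + 1 then 2 * r else 2 * r + 1) {..r}"
      using r by (auto simp: edge_def edge2_def)
    then show ?thesis using r by simp
  qed
qed

lemma card_antidiag:
  fixes n :: nat
  assumes "\<And>k. k < n \<Longrightarrow> P k \<longleftrightarrow> Q (n - 1 - k)"
  shows "card {k. k < n \<and> P k} = card {k. k < n \<and> Q k}"
  by (rule bij_betw_same_card[of "\<lambda>k. n - 1 - k"],
      rule bij_betw_byWitness[where f' = "\<lambda>k. n - 1 - k"])
    (use assms in auto)

text \<open>Reflection in the anti-diagonal exchanges the two diagonal blocks and fixes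
  \<open>B\<close> and \<open>J\<close>.\<close>

lemma edge_antidiag:
  assumes r: "r \<ge> 2" and k: "k < 2 * r + 2" and j: "j < 2 * r + 2"
  shows "edge r (2 * r + 1 - j) (2 * r + 1 - k) \<longleftrightarrow> edge r k j"
proof -
  let ?j = "2 * r + 1 - j" and ?k = "2 * r + 1 - k"
  have single: "?j = 0 \<longleftrightarrow> j = 2 * r + 1" "?k < r \<longleftrightarrow> r + 1 < k"
    "?j = 1 \<longleftrightarrow> j = 2 * r" "?k = r \<longleftrightarrow> k = r + 1"
    "r < ?j \<longleftrightarrow> j \<le> r" "?k \<le> r \<longleftrightarrow> r < k"
    "r + 1 < ?j \<longleftrightarrow> j < r" "?k = 2 * r + 1 \<longleftrightarrow> k = 0"
    "?j = r + 1 \<longleftrightarrow> j = r" "?k = 2 * r \<longleftrightarrow> k = 1"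
    using k j by linarith+
  \<comment> \<open>The diagonals of \<open>B\<close> link both indices, so each is transformed as a
    whole; it is mapped to itself.\<close>
  have double: "?j \<le> r \<and> ?k = r + 1 + ?j \<longleftrightarrow> k \<le> r \<and> j = r + 1 + k"
    "1 \<le> ?j \<and> ?j \<le> r \<and> ?k = r + ?j \<longleftrightarrow> 1 \<le> k \<and> k \<le> r \<and> j = r + k"
    using k j by linarith+
  show ?thesis
    unfolding edge_def double unfolding single by (simp only: conj_ac disj_ac)
qed

text \<open>The reflection reverses products, so the symmetry passes to the square; here it is
  checked on the explicit support.\<close>

lemma edge2_antidiag:
  assumes r: "r \<ge> 2" and k: "k < 2 * r + 2" and j: "j < 2 * r + 2"
  shows "edge2 r (2 * r + 1 - j) (2 * r + 1 - k) \<longleftrightarrow> edge2 r k j"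
proof -
  let ?j = "2 * r + 1 - j" and ?k = "2 * r + 1 - k"
  have "?j = 0 \<longleftrightarrow> j = 2 * r + 1" "?k \<le> 2 * r \<longleftrightarrow> 1 \<le> k"
    "1 \<le> ?j \<longleftrightarrow> j \<le> 2 * r" "?k = 2 * r + 1 \<longleftrightarrow> k = 0"
    "?j = 1 \<longleftrightarrow> j = 2 * r" "?k = 2 * r \<longleftrightarrow> k = 1"
    "r < ?j \<longleftrightarrow> j \<le> r" "?k \<le> r \<longleftrightarrow> r < k"
    using k j by linarith+
  then show ?thesis
    unfolding edge2_def by argo
qed

lemma card_edge2_col:
  assumes r: "r \<ge> 2" and j: "j < 2 * r + 2"
  shows "card {k. k < 2 * r + 2 \<and> edge2 r k j} = r + card {k. k < 2 * r + 2 \<and> edge r k j}"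
proof -
  have "card {k. k < 2 * r + 2 \<and> edge2 r k j} =
      card {k. k < 2 * r + 2 \<and> edge2 r (2 * r + 1 - j) k}"
    by (rule card_antidiag) (use edge2_antidiag[OF r _ j] in simp)
  moreover have "card {k. k < 2 * r + 2 \<and> edge r k j} =
      card {k. k < 2 * r + 2 \<and> edge r (2 * r + 1 - j) k}"
    by (rule card_antidiag) (use edge_antidiag[OF r _ j] in simp)
  ultimately show ?thesis
    using card_edge2_row[OF r, of "2 * r + 1 - j"] by simp
qed

text \<open>Both sides count, up to the factor 2 of \<open>card_two_paths\<close>, the paths of length 3
  from \<open>i\<close> to \<open>j\<close>.\<close>

lemma card_three_paths:
  assumes r: "r \<ge> 2" and i: "i < 2 * r + 2" and j: "j < 2 * r + 2"
  shows "card {k. k < 2 * r + 2 \<and> edge r i k \<and> edge2 r k j} =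
    card {k. k < 2 * r + 2 \<and> edge2 r i k \<and> edge r k j}"
proof -
  define n where "n = 2 * r + 2"
  have card_sum: "card {k. k < n \<and> P k} = (\<Sum>k<n. of_bool (P k))" for P
    by (simp add: of_bool_def sum.If_cases Int_def)
  have two: "(\<Sum>k<n. of_bool (edge r a k) * of_bool (edge r k b)) = (2 :: nat) * of_bool (edge2 r a b)"
    if "a < n" "b < n" for a b
    using card_two_paths[OF r that[unfolded n_def], folded n_def]
    unfolding card_sum of_bool_conj by simp
  have "2 * card {k. k < n \<and> edge r i k \<and> edge2 r k j} =
      (\<Sum>k<n. 2 * of_bool (edge r i k \<and> edge2 r k j))"
    unfolding card_sum by (rule sum_distrib_left)
  also have "\<dots> = (\<Sum>k<n. of_bool (edge r i k) * (\<Sum>l<n. of_bool (edge r k l) * of_bool (edge r l j)))"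
    using j[folded n_def] by (intro sum.cong refl) (subst two, simp_all)
  \<comment> \<open>Interchanging the summations is associativity of the matrix product.\<close>
  also have "\<dots> = (\<Sum>l<n. (\<Sum>k<n. of_bool (edge r i k) * of_bool (edge r k l)) * of_bool (edge r l j))"
    unfolding sum_distrib_left sum_distrib_right by (subst sum.swap) (simp only: mult.assoc)
  also have "\<dots> = (\<Sum>l<n. 2 * of_bool (edge2 r i l \<and> edge r l j))"
    using i[folded n_def] by (intro sum.cong refl) (subst two, simp_all)
  also have "\<dots> = 2 * card {l. l < n \<and> edge2 r i l \<and> edge r l j}"
    unfolding card_sum by (rule sum_distrib_left[symmetric])
  finally show ?thesis by (simp add: n_def)
qed

section \<open>Alternating sum of the level sizes\<close>

text \<open>For \<open>l \<le> m\<close> this is the size of level \<open>l\<close>, counted from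
  the bottom, in an interval of length \<open>m\<close>.\<close>

definition level_count :: "nat \<Rightarrow> nat \<Rightarrow> nat \<Rightarrow> nat \<Rightarrow> nat \<Rightarrow> nat" where
  "level_count r m i j l = card {k. k < 2 * r + 2 \<and> reach r l i k \<and> reach r (m - l) k j}"

lemma alternating_level_count:
  assumes r: "r \<ge> 2" and i: "i < 2 * r + 2" and j: "j < 2 * r + 2"
    and m: "m > 0" and reach: "reach r m i j"
  shows "(\<Sum>l\<le>m. (-1) ^ l * int (level_count r m i j l)) = 0"
proof -
  let ?n = "2 * r + 2" and ?c = "level_count r m i j"
  have ends: "?c 0 = 1" "?c m = 1"
  proof -
    have "{k. k < ?n \<and> reach r 0 i k \<and> reach r (m - 0) k j} = {i}"
      using i reach by (auto simp: reach_def)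
    then show "?c 0 = 1" by (simp add: level_count_def)
    have "{k. k < ?n \<and> reach r m i k \<and> reach r (m - m) k j} = {j}"
      using j reach by (auto simp: reach_def)
    then show "?c m = 1" by (simp add: level_count_def)
  qed
  define a where "a = card {k. k < ?n \<and> edge r i k}"
  define b where "b = card {k. k < ?n \<and> edge r k j}"
  note row = card_edge2_row[OF r i, folded a_def]
  note col = card_edge2_col[OF r j, folded b_def]
  \<comment> \<open>From length \<open>5\<close> on, the two levels next to the bottom are disjoint
    from the two next to the top; shorter intervals are treated singly.\<close>
  consider "m = 1" | "m = 2" | "m = 3" | "m = 4" | "m \<ge> 5"
    using m by linarith
  then show ?thesis
  proof cases
    case 1
    then show ?thesis using ends by simp
  next
    case 2
    then have "?c 1 = 2"
      using reach card_two_paths[OF r i j] by (simp add: level_count_def reach_def)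
    then show ?thesis using ends 2 by (simp add: numeral_2_eq_2)
  next
    case 3
    then have "?c 1 = ?c 2"
      using card_three_paths[OF r i j] by (simp add: level_count_def reach_def)
    then show ?thesis using ends 3 by (simp add: eval_nat_numeral)
  next
    case 4
    then have "?c 1 = a" "?c 3 = b"
      by (simp_all add: level_count_def reach_def a_def b_def)
    \<comment> \<open>Inclusion and exclusion: the middle level is the intersection of a row support
      and a column support whose union is everything.\<close>
    moreover have "?c 2 + ?n = (r + a) + (r + b)"
    proof -
      let ?A = "{k. k < ?n \<and> edge2 r i k}" and ?B = "{k. k < ?n \<and> edge2 r k j}"
      \<comment> \<open>The zeros of row \<open>i\<close> of the square lie in the second half of the indices,
        those of column \<open>j\<close> in the first half.\<close>
      have "edge2 r i k \<or> edge2 r k j" for k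
        by (cases "k \<le> r") (simp_all add: edge2_def)
      then have "?A \<union> ?B = {..<?n}" by auto
      moreover have "?A \<inter> ?B = {k. k < ?n \<and> edge2 r i k \<and> edge2 r k j}" by auto
      ultimately show ?thesis
        using card_Un_Int[of ?A ?B] row col 4 by (simp add: level_count_def reach_def)
    qed
    ultimately show ?thesis using ends 4 by (simp add: eval_nat_numeral)
  next
    case 5
    \<comment> \<open>The full levels are \<open>3\<close> to \<open>q + 2\<close>, so
      \<open>q\<close> is their number.\<close>
    define q where "q = m - 5"
    have q: "m = q + 5" using 5 by (simp add: q_def)
    have mid: "?c l = ?n" if "3 \<le> l" "l < q + 3" for l
    proof -
      have "m - l \<noteq> 0" "m - l \<noteq> 1" "m - l \<noteq> 2" using that q by auto
      then show ?thesis using that by (simp add: level_count_def reach_def)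
    qed
    have lows: "?c 1 = a" "?c 2 = r + a"
      using q row by (simp_all add: level_count_def reach_def a_def)
    have highs: "?c (q + 3) = r + b" "?c (q + 4) = b"
      using q col by (simp_all add: level_count_def reach_def b_def)
    \<comment> \<open>Consecutive full levels cancel; an unpaired one has the sign of level
      \<open>3\<close>, which is negative.\<close>
    have alt: "(\<Sum>l<q. (-1) ^ (l + 3) * int ?n) = (if odd q then - int ?n else 0)"
      by (induction q) auto
    have "(\<Sum>l\<le>m. (-1) ^ l * int (?c l)) =
        (\<Sum>l<3. (-1) ^ l * int (?c l)) + (\<Sum>l=3..<q + 3. (-1) ^ l * int (?c l))
        + (-1) ^ (q + 3) * int (?c (q + 3)) + (-1) ^ (q + 4) * int (?c (q + 4))
        + (-1) ^ m * int (?c m)"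
    proof -
      have "{..m} = {..<Suc (Suc (Suc (q + 3)))}" using q by auto
      then have "(\<Sum>l\<le>m. f l) = (\<Sum>l<q + 3. f l) + f (q + 3) + f (q + 4) + f m" for f :: "nat \<Rightarrow> int"
        by (simp add: q eval_nat_numeral)
      moreover have "(\<Sum>l<q + 3. f l) = (\<Sum>l<3. f l) + (\<Sum>l=3..<q + 3. f l)" for f :: "nat \<Rightarrow> int"
        using sum.atLeastLessThan_concat[of 0 3 "q + 3" f] by (simp add: atLeast0LessThan)
      ultimately show ?thesis by simp
    qed
    also have "(\<Sum>l=3..<q + 3. (-1) ^ l * int (?c l)) = (\<Sum>l=0 + 3..<q + 3. (-1) ^ l * int ?n)"
      using mid by (intro sum.cong) auto
    also have "\<dots> = (if odd q then - int ?n else 0)"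
      unfolding sum.shift_bounds_nat_ivl atLeast0LessThan alt ..
    \<comment> \<open>This is \<open>1 - a + (r + a)\<close>: the dependence on the row cancels. The
      top three levels likewise give \<open>1 + r\<close> for odd \<open>q\<close> and its negative
      for even \<open>q\<close>.\<close>
    also have "(\<Sum>l<3. (-1) ^ l * int (?c l)) = 1 + int r"
      using ends(1) lows by (simp add: eval_nat_numeral)
    finally show ?thesis
      unfolding highs ends(2) by (cases "even q") (simp_all add: q)
  qed
qed

section \<open>The Eulerian property\<close>

lemma card_even_odd_N_interval:
  assumes r: "r \<ge> 2" and le: "((i, s), (j, p)) \<in> level_le (N_mat r)" and ne: "(i, s) \<noteq> (j, p)"
  defines "I \<equiv> poset_interval (level_le (N_mat r)) (i, s) (j, p)"
  shows "finite I \<and> card {z \<in> I. even (snd z)} = card {z \<in> I. odd (snd z)}"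
proof -
  define m where "m = nat (p - s)"
  have ij: "i < 2 * r + 2" "j < 2 * r + 2" and "s \<le> p" and reach: "reach r m i j"
    using le unfolding level_le_N_mat[OF r] m_def by auto
  have p: "p = s + int m" using \<open>s \<le> p\<close> by (simp add: m_def)
  have "m > 0" using ne reach p by (auto simp: reach_def intro: gr0I)
  define F where "F l = {k. k < 2 * r + 2 \<and> reach r l i k \<and> reach r (m - l) k j}" for l
  let ?g = "\<lambda>(l, k). (k :: nat, s + int l)"
  \<comment> \<open>The interval is sliced into levels, indexed by the height \<open>l\<close> above
    its bottom.\<close>
  have I: "I = ?g ` Sigma {..m} F"
  proof (intro equalityI subsetI)
    fix z assume "z \<in> I"
    then obtain k t where z: "z = (k, t)"
      "((i, s), (k, t)) \<in> level_le (N_mat r)" "((k, t), (j, p)) \<in> level_le (N_mat r)"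
      by (cases z) (auto simp: I_def poset_interval_def)
    then have t: "s \<le> t" "t \<le> p"
      unfolding level_le_N_mat[OF r] by auto
    then have "nat (p - t) = m - nat (t - s)"
      using p by linarith
    with z have "k \<in> F (nat (t - s))"
      unfolding level_le_N_mat[OF r] by (auto simp: F_def)
    then show "z \<in> ?g ` Sigma {..m} F"
      using z(1) t by (intro image_eqI[of _ _ "(nat (t - s), k)"]) (auto simp: p)
  next
    fix z assume "z \<in> ?g ` Sigma {..m} F"
    then obtain l k where z: "z = (k, s + int l)" and l: "l \<le> m" and k: "k \<in> F l"
      by auto
    have "nat (p - (s + int l)) = m - l"
      using p l by linarith
    then show "z \<in> I"
      using ij l k by (auto simp: z I_def poset_interval_def level_le_N_mat[OF r] F_def p)
  qed
  have finF: "finite (F l)" for l by (simp add: F_def)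
  have fin: "finite I" unfolding I by (intro finite_imageI finite_SigmaI finF) simp
  have inj: "inj_on ?g (Sigma {..m} F)" by (auto simp: inj_on_def)
  define \<sigma> :: "int \<Rightarrow> int" where "\<sigma> t = (if even t then 1 else -1)" for t
  \<comment> \<open>Parity of the rank and parity of the height differ only by the global sign
    \<open>\<sigma> s\<close>, which does not affect vanishing.\<close>
  have \<sigma>: "\<sigma> (s + int l) = \<sigma> s * (-1) ^ l" for l by (auto simp: \<sigma>_def)
  have "int (card {z \<in> I. even (snd z)}) - int (card {z \<in> I. odd (snd z)}) = (\<Sum>z\<in>I. \<sigma> (snd z))"
  proof -
    have "(\<Sum>z\<in>I. \<sigma> (snd z)) = (\<Sum>z\<in>{z \<in> I. even (snd z)} \<union> {z \<in> I. odd (snd z)}. \<sigma> (snd z))"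
      by (intro sum.cong) auto
    also have "\<dots> = (\<Sum>z | z \<in> I \<and> even (snd z). \<sigma> (snd z)) + (\<Sum>z | z \<in> I \<and> odd (snd z). \<sigma> (snd z))"
      using fin by (intro sum.union_disjoint) auto
    finally show ?thesis by (simp add: \<sigma>_def)
  qed
  also have "\<dots> = (\<Sum>(l, k)\<in>Sigma {..m} F. \<sigma> (s + int l))"
    unfolding I sum.reindex[OF inj] by (intro sum.cong) auto
  also have "\<dots> = (\<Sum>l\<le>m. \<Sum>k\<in>F l. \<sigma> (s + int l))"
    by (rule sum.Sigma[symmetric]) (auto simp: finF)
  also have "\<dots> = \<sigma> s * (\<Sum>l\<le>m. (-1) ^ l * int (level_count r m i j l))"
    by (simp add: \<sigma> sum_distrib_left level_count_def F_def mult_ac)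
  finally show ?thesis
    using fin alternating_level_count[OF r ij \<open>m > 0\<close> reach] by simp
qed

text \<open>This holds for every matrix: strict growth of the rank gives antisymmetry, and the
  covers are exactly the single steps.\<close>

lemma ranked_poset_level: "ranked_poset (level_elems X) (level_le X) level_rank"
proof -
  have "refl_on (level_elems X) (level_le X)"
    by (auto simp: level_le_def refl_on_def)
  moreover have "level_le X \<subseteq> level_elems X \<times> level_elems X"
    by (auto simp: level_le_def)
  moreover have "trans (level_le X)"
    unfolding level_le_def by (rule transI) (blast intro: rtrancl_trans)
  moreover have "antisym (level_le X)"
    unfolding level_le_def by (rule antisymI) (fastforce dest: level_step_rank)
  ultimately have "partial_order_on (level_elems X) (level_le X)"
    by (simp add: partial_order_on_def preorder_on_def)
  moreover have "\<forall>x y. (x, y) \<in> level_le X \<and> x \<noteq> y \<longrightarrow> snd x < snd y"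
    unfolding level_le_def by (blast dest: level_step_rank)
  ultimately show ?thesis
    unfolding ranked_poset_def covers_level_le by (auto simp: level_step_def)
qed

theorem proposition5p2:
  fixes r :: nat
  assumes "r \<ge> 2"
  shows "primitive_mat (N_mat r) \<and> mat_exponent (N_mat r) = 3 \<and>
         eulerian_poset (level_elems (N_mat r)) (level_le (N_mat r)) level_rank"
  unfolding eulerian_poset_def
  using primitive_N_mat[OF assms] mat_exponent_N_mat[OF assms] ranked_poset_level
    card_even_odd_N_interval[OF assms]
  by auto

end
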